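(* Given a family of $m\times m$-valued positive real rational functions $F(s)$ of McMillan degree of at most $n$, with no poles at infinity, consider the corresponding $(n+m)\times(n+m)$ state-space realization arrays (not assumed minimal) $$R=\begin{pmatrix}A&B\\ C&D\end{pmatrix},\qquad F(s)=C(sI_n-A)^{-1}B+D,$$ which satisfy $$\begin{pmatrix}-I_n&0\\0&I_m\end{pmatrix}R+R^*\begin{pmatrix}-I_n&0\\0&I_m\end{pmatrix}=Q,\qquad Q\in\overline{\mathbf{P}}_{n+m}.$$ Then (as matrices) this family of realizations is an $n,m$-matrix-convex cone, closed under inversion.
   Context: $\overline{\mathbf{P}}_{k}$ denotes the set of $k\times k$ Hermitian positive semidefinite matrices and $\mathbf{P}_k$ the positive definite ones. An $m\times m$-valued rational function $F(s)$, with $F(s)\in\mathbb{R}^{m\times m}$ for $s\in\mathbb{R}$, is positive real if it analytically maps the open right half plane to $\{A\in\mathbb{C}^{m\times m}: A+A^*\in\overline{\mathbf{P}}_m\}\cup\{\infty\}$. A set $\mathbf{R}$ of $(n+m)\times(n+m)$ matrices is closed under inversion if whenever $R\in\mathbf{R}$ is a non-singular matrix, $R^{-1}\in\mathbf{R}$. It is an $n,m$-matrix-convex cone if for all natural $k$, all $R_1,\dots,R_k\in\mathbf{R}$, and all block-diagonal $\upsilon_j=\begin{pmatrix}\upsilon_{j,n}&0\\0&\upsilon_{j,m}\end{pmatrix}\in\mathbb{C}^{(n+m)\times(n+m)}$, with $\upsilon_{j,n}$ of size $n\times n$ and $\upsilon_{j,m}$ of size $m\times m$, such that $\sum_{j=1}^k\upsilon_j^*\upsilon_j=\begin{pmatrix}P_n&0\\0&P_m\end{pmatrix}$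 for some $P_n\in\mathbf{P}_n$, $P_m\in\mathbf{P}_m$, one has $\sum_{j=1}^k\upsilon_j^*R_j\upsilon_j\in\mathbf{R}$.
   Formalization: With F real on the real axis and complex weights the cone claim fails (D=[[0,1],[-1,0]], weight diag(1,i)); proved: cone and inversion without realness of F; the same for real F, real arrays and real weights; inversion for all arrays with positive real F. *)

theory Defs
  imports
    "Jordan_Normal_Form.Schur_Decomposition"
    "Jordan_Normal_Form.Determinant"
    "HOL-Computational_Algebra.Computational_Algebra"
    "HOL-Computational_Algebra.Field_as_Ring"
begin

definition psd_mats :: "nat \<Rightarrow> complex mat set" where
  "psd_mats k = {P \<in> carrier_mat k k. mat_adjoint P = P \<and>
     (\<forall>v \<in> carrier_vec k. 0 \<le> Re ((P *\<^sub>v v) \<bullet>c v))}"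

definition pd_mats :: "nat \<Rightarrow> complex mat set" where
  "pd_mats k = {P \<in> carrier_mat k k. mat_adjoint P = P \<and>
     (\<forall>v \<in> carrier_vec k. v \<noteq> 0\<^sub>v k \<longrightarrow> 0 < Re ((P *\<^sub>v v) \<bullet>c v))}"

text \<open>
  Matrix-valued rational functions are matrices over the field of fractions of complex
  polynomials. Numerator and denominator of an entry are taken in lowest terms, so the
  poles are exactly the zeros of the denominators.
\<close>

type_synonym rational_mat = "complex poly fract mat"

definition num :: "complex poly fract \<Rightarrow> complex poly" where
  "num f = fst (quot_of_fract f)"

definition den :: "complex poly fract \<Rightarrow> complex poly" where
  "den f = snd (quot_of_fract f)"

definition has_pole :: "rational_mat \<Rightarrow> complex \<Rightarrow> bool" where
  "has_pole F s \<longleftrightarrow> (\<exists>f \<in> elements_mat F. poly (den f) s = 0)"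

text \<open>The value is meaningful only at points \<open>s\<close> with \<open>\<not> has_pole F s\<close>.\<close>

definition value_at :: "rational_mat \<Rightarrow> complex \<Rightarrow> complex mat" where
  "value_at F s = map_mat (\<lambda>f. poly (num f) s / poly (den f) s) F"

definition no_pole_at_infinity :: "rational_mat \<Rightarrow> bool" where
  "no_pole_at_infinity F \<longleftrightarrow> (\<forall>f \<in> elements_mat F. degree (num f) \<le> degree (den f))"

text \<open>
  \<open>F\<close> maps the open right half plane to \<open>{A. A + A\<^sup>* \<in> psd_mats m} \<union> {\<infinity>}\<close>; the value
  \<open>\<infinity>\<close> is attained precisely at a pole, and analyticity of such a map is automatic for a
  rational \<open>F\<close>. (In fact no pole can lie in the open right half plane.) The predicate
  \<open>positive\<close> is positive realness without the requirement that \<open>F\<close> be real on the real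
  axis. It is kept apart because congruence of arrays with non-real weights destroys
  realness of \<open>F\<close>: for \<open>F = D\<close> constant, real, skew-symmetric of size 2 and the weight
  diag(1, i), the result is not real.
\<close>

definition positive :: "nat \<Rightarrow> rational_mat \<Rightarrow> bool" where
  "positive m F \<longleftrightarrow> F \<in> carrier_mat m m \<and>
     (\<forall>s. 0 < Re s \<longrightarrow>
        has_pole F s \<or> value_at F s + mat_adjoint (value_at F s) \<in> psd_mats m)"

definition positive_real :: "nat \<Rightarrow> rational_mat \<Rightarrow> bool" where
  "positive_real m F \<longleftrightarrow> positive m F \<and>
     (\<forall>s \<in> \<real>. \<not> has_pole F s \<longrightarrow> elements_mat (value_at F s) \<subseteq> \<real>)"

text \<open>\<open>F(s) = C (s I\<^sub>k - A)\<inverse> B + D\<close>, with state dimension \<open>k\<close>, not assumed minimal.\<close>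

definition realizes ::
  "nat \<Rightarrow> nat \<Rightarrow> complex mat \<Rightarrow> complex mat \<Rightarrow> complex mat \<Rightarrow> complex mat \<Rightarrow> rational_mat \<Rightarrow> bool"
where
  "realizes k m A B C D F \<longleftrightarrow>
     A \<in> carrier_mat k k \<and> B \<in> carrier_mat k m \<and> C \<in> carrier_mat m k \<and> D \<in> carrier_mat m m \<and>
     F \<in> carrier_mat m m \<and>
     (\<forall>s. det (s \<cdot>\<^sub>m 1\<^sub>m k - A) \<noteq> 0 \<longrightarrow>
        \<not> has_pole F s \<and>
        value_at F s = C * the (mat_inverse (s \<cdot>\<^sub>m 1\<^sub>m k - A)) * B + D)"

text \<open>
  The McMillan degree of an \<open>m \<times> m\<close>-valued rational function without pole at infinity is the
  state dimension of a minimal realization. It is used only for such functions.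
\<close>

definition mcmillan_degree :: "nat \<Rightarrow> rational_mat \<Rightarrow> nat" where
  "mcmillan_degree m F = (LEAST k. \<exists>A B C D. realizes k m A B C D F)"

definition signature :: "nat \<Rightarrow> nat \<Rightarrow> complex mat" where
  "signature n m = four_block_mat (- 1\<^sub>m n) (0\<^sub>m n m) (0\<^sub>m m n) (1\<^sub>m m)"

definition realization_arrays :: "nat \<Rightarrow> nat \<Rightarrow> rational_mat set \<Rightarrow> complex mat set" where
  "realization_arrays n m \<F> = {R. \<exists>A B C D F. F \<in> \<F> \<and> realizes n m A B C D F \<and>
     R = four_block_mat A B C D \<and>
     (\<exists>Q \<in> psd_mats (n + m). signature n m * R + mat_adjoint R * signature n m = Q)}"

definition positive_functions :: "nat \<Rightarrow> nat \<Rightarrow> rational_mat set" where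
  "positive_functions n m =
     {F. positive m F \<and> no_pole_at_infinity F \<and> mcmillan_degree m F \<le> n}"

definition positive_real_functions :: "nat \<Rightarrow> nat \<Rightarrow> rational_mat set" where
  "positive_real_functions n m =
     {F. positive_real m F \<and> no_pole_at_infinity F \<and> mcmillan_degree m F \<le> n}"

definition real_mats :: "complex mat set" where
  "real_mats = {R. elements_mat R \<subseteq> \<real>}"

definition closed_under_inversion :: "complex mat set \<Rightarrow> bool" where
  "closed_under_inversion \<R> \<longleftrightarrow>
     (\<forall>R \<in> \<R>. invertible_mat R \<longrightarrow> the (mat_inverse R) \<in> \<R>)"

text \<open>
  The weights \<open>\<upsilon>\<^sub>j\<close> have entries in \<open>K\<close>: the usual notion has \<open>K = UNIV\<close>, the notion over
  the reals (for sets of real matrices) has \<open>K = \<real>\<close>.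
\<close>

definition matrix_convex_cone ::
  "complex set \<Rightarrow> nat \<Rightarrow> nat \<Rightarrow> complex mat set \<Rightarrow> bool"
where
  "matrix_convex_cone K n m \<R> \<longleftrightarrow> \<R> \<subseteq> carrier_mat (n + m) (n + m) \<and>
     (\<forall>k (R :: nat \<Rightarrow> complex mat) (\<upsilon> :: nat \<Rightarrow> complex mat).
        (\<forall>j<k. R j \<in> \<R>) \<longrightarrow>
        (\<forall>j<k. elements_mat (\<upsilon> j) \<subseteq> K \<and>
           (\<exists>\<upsilon>n \<in> carrier_mat n n. \<exists>\<upsilon>m \<in> carrier_mat m m.
              \<upsilon> j = four_block_mat \<upsilon>n (0\<^sub>m n m) (0\<^sub>m m n) \<upsilon>m)) \<longrightarrow>
        (\<exists>Pn \<in> pd_mats n. \<exists>Pm \<in> pd_mats m.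
           mat (n + m) (n + m) (\<lambda>ij. \<Sum>j<k. (mat_adjoint (\<upsilon> j) * \<upsilon> j) $$ ij)
             = four_block_mat Pn (0\<^sub>m n m) (0\<^sub>m m n) Pm) \<longrightarrow>
        mat (n + m) (n + m) (\<lambda>ij. \<Sum>j<k. (mat_adjoint (\<upsilon> j) * R j * \<upsilon> j) $$ ij) \<in> \<R>)"

end

(*
  The signature J = diag(-I, I) commutes with block-diagonal weights and is Hermitian, so the
  condition J R + R^* J >= 0, written as Re <J R v, v> >= 0 for all v, passes to v^* R v, to sums
  and to inverses (put v = R w). The other conditions on the arrays are consequences of it: if
  (x, u) is mapped by R to (s x, y), then y = F(s) u and Re <F(s) u, u> >= Re s |x|^2, so F is
  positive, and C (s I - A)^(-1) B + D always defines a rational F without pole at infinity and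
  of McMillan degree at most n. What remains is that F is real on the real axis; since F is
  rational, it is enough to know this at all but finitely many real points.
*)

theory Submission
  imports Defs
begin

section \<open>Adjoints and positive semidefinite matrices\<close>

text \<open>Realness of \<open>F\<close> and realness of the array \<open>R\<close> are different
  conditions: a unitary change of the state coordinates keeps both \<open>F\<close> and the
  inequality, yet can turn real entries of \<open>R\<close> into complex ones. This is why there are
  three claims: for complex weights realness is dropped, for real weights it is imposed on the
  array, and in the last claim it is imposed on \<open>F\<close> alone. In the first two cases the
  arrays are exactly the solutions of the inequality (with real entries in the second case), so
  \<open>F\<close> disappears from the problem. The last case has no such description: realness has
  to be carried from \<open>F\<close> to the function of the inverse array, whose own entries reveal
  nothing about it.\<close>

lemma mat_adjoint_dim [simp]:
  "dim_row (mat_adjoint A) = dim_col A" "dim_col (mat_adjoint A) = dim_row A"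
  by (simp_all add: mat_adjoint_def)

lemma mat_adjoint_carrier: "A \<in> carrier_mat nr nc \<Longrightarrow> mat_adjoint A \<in> carrier_mat nc nr"
  by (rule carrier_matI) auto

lemma mat_adjoint_index [simp]:
  "i < dim_col A \<Longrightarrow> j < dim_row A \<Longrightarrow> mat_adjoint A $$ (i, j) = conjugate (A $$ (j, i))"
  by (simp add: mat_adjoint_def mat_of_rows_def)

lemma cscalar_prod_mat_adjoint:
  assumes A: "A \<in> carrier_mat nr nc" and x: "x \<in> carrier_vec nc" and y: "y \<in> carrier_vec nr"
  shows "(A *\<^sub>v x) \<bullet>c y = x \<bullet>c (mat_adjoint A *\<^sub>v y)"
proof -
  \<comment> \<open>Conjugation cancels the one inside the adjoint; what is left is the rule for the
    transpose under the bilinear product.\<close>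
  have "conjugate (mat_adjoint A *\<^sub>v y) = A\<^sup>T *\<^sub>v conjugate y"
    using A y
    by (intro eq_vecI) (auto simp: scalar_prod_def sum_conjugate conjugate_dist_mul)
  then show ?thesis
    using transpose_vec_mult_scalar[OF A x, of "conjugate y"] A x y
    by (smt (verit) carrier_vec_conjugate comm_scalar_prod mult_mat_vec_carrier transpose_carrier_mat)
qed

lemma mat_adjoint_add:
  assumes "A \<in> carrier_mat nr nc" "B \<in> carrier_mat nr nc"
  shows "mat_adjoint (A + B) = mat_adjoint A + mat_adjoint B"
  using assms by (intro eq_matI) (auto simp: conjugate_dist_add)

lemma mat_adjoint_mult:
  assumes "A \<in> carrier_mat nr n" "B \<in> carrier_mat n nc"
  shows "mat_adjoint (A * B) = mat_adjoint B * mat_adjoint A"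
proof (rule eq_matI)
  fix i j assume "i < dim_row (mat_adjoint B * mat_adjoint A)" "j < dim_col (mat_adjoint B * mat_adjoint A)"
  then have ij: "i < nc" "j < nr" using assms by auto
  have "conjugate ((A * B) $$ (j, i)) = (\<Sum>k = 0..<n. conjugate (A $$ (j, k) * B $$ (k, i)))"
    using assms ij by (simp add: scalar_prod_def sum_conjugate)
  also have "\<dots> = (mat_adjoint B * mat_adjoint A) $$ (i, j)"
    using assms ij by (simp add: scalar_prod_def conjugate_dist_mul mult.commute)
  finally show "mat_adjoint (A * B) $$ (i, j) = (mat_adjoint B * mat_adjoint A) $$ (i, j)"
    using assms ij by simp
qed (use assms in auto)

lemma mat_adjoint_adjoint [simp]: "mat_adjoint (mat_adjoint A) = A"
  by (intro eq_matI) auto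

lemma Re_cscalar_prod_commute:
  assumes "v \<in> carrier_vec n" "w \<in> carrier_vec n"
  shows "Re (v \<bullet>c w) = Re (w \<bullet>c v)"
  using assms by (simp add: scalar_prod_def mult.commute)

text \<open>The forms of \<open>M\<close> and of its adjoint at \<open>v\<close> are conjugate to
  each other, so the form of the sum is twice the real part of the form of \<open>M\<close>; the sum
  is Hermitian by itself. This trades matrix inequalities for inequalities between vectors.\<close>

lemma add_mat_adjoint_in_psd_mats_iff:
  assumes M: "M \<in> carrier_mat k k"
  shows "M + mat_adjoint M \<in> psd_mats k \<longleftrightarrow> (\<forall>v \<in> carrier_vec k. 0 \<le> Re ((M *\<^sub>v v) \<bullet>c v))"
proof -
  have "Re (((M + mat_adjoint M) *\<^sub>v v) \<bullet>c v) = 2 * Re ((M *\<^sub>v v) \<bullet>c v)"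
    if v: "v \<in> carrier_vec k" for v
  proof -
    have "((M + mat_adjoint M) *\<^sub>v v) \<bullet>c v = (M *\<^sub>v v) \<bullet>c v + (mat_adjoint M *\<^sub>v v) \<bullet>c v"
      using M v mat_adjoint_carrier[OF M]
      by (simp add: add_mult_distrib_mat_vec[where nr=k and nc=k] add_scalar_prod_distrib[where n=k])
    moreover have "(mat_adjoint M *\<^sub>v v) \<bullet>c v = v \<bullet>c (M *\<^sub>v v)"
      using cscalar_prod_mat_adjoint[of "mat_adjoint M" k k v v] M mat_adjoint_carrier[OF M] v by simp
    ultimately show ?thesis
      using M v Re_cscalar_prod_commute[of v k "M *\<^sub>v v"] by simp
  qed
  moreover have "mat_adjoint (M + mat_adjoint M) = M + mat_adjoint M"
    using M mat_adjoint_carrier[OF M] by (simp add: mat_adjoint_add[of _ k k] comm_add_mat[of _ k k])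
  ultimately show ?thesis
    using M mat_adjoint_carrier[OF M] by (auto simp: psd_mats_def)
qed

section \<open>Dissipative arrays\<close>

lemma signature_carrier: "signature n m \<in> carrier_mat (n + m) (n + m)"
  by (simp add: signature_def)

lemma signature_mult_vec_carrier [simp]:
  "signature n m *\<^sub>v v \<in> carrier_vec (n + m)"
  by (rule carrier_vecI) (simp add: signature_def)

lemma mat_adjoint_signature [simp]: "mat_adjoint (signature n m) = signature n m"
  by (intro eq_matI) (auto simp: signature_def)

text \<open>In the indefinite inner product given by the signature, this says that \<open>R\<close>
  is accretive. For \<open>m = 0\<close> it says that \<open>A\<close> is a dissipative operator,
  for \<open>n = 0\<close> that \<open>D\<close> has positive semidefinite Hermitian part.\<close>

definition dissipative :: "nat \<Rightarrow> nat \<Rightarrow> complex mat set" where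
  "dissipative n m = {R \<in> carrier_mat (n + m) (n + m).
     \<forall>v \<in> carrier_vec (n + m). 0 \<le> Re ((signature n m *\<^sub>v (R *\<^sub>v v)) \<bullet>c v)}"

lemma dissipative_carrier: "R \<in> dissipative n m \<Longrightarrow> R \<in> carrier_mat (n + m) (n + m)"
  by (simp add: dissipative_def)

lemma dissipativeD:
  "R \<in> dissipative n m \<Longrightarrow> v \<in> carrier_vec (n + m) \<Longrightarrow> 0 \<le> Re ((signature n m *\<^sub>v (R *\<^sub>v v)) \<bullet>c v)"
  by (simp add: dissipative_def)

lemma dissipative_iff:
  assumes R: "R \<in> carrier_mat (n + m) (n + m)"
  shows "R \<in> dissipative n m \<longleftrightarrow>
    signature n m * R + mat_adjoint R * signature n m \<in> psd_mats (n + m)"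
proof -
  have "mat_adjoint (signature n m * R) = mat_adjoint R * signature n m"
    using R by (simp add: mat_adjoint_mult[OF signature_carrier])
  then show ?thesis
    using R add_mat_adjoint_in_psd_mats_iff[OF mult_carrier_mat[OF signature_carrier R]]
    by (simp add: dissipative_def assoc_mult_mat_vec[OF signature_carrier R])
qed

lemma zero_in_dissipative: "0\<^sub>m (n + m) (n + m) \<in> dissipative n m"
proof -
  have "signature n m *\<^sub>v (0\<^sub>m (n + m) (n + m) *\<^sub>v v) = 0\<^sub>v (n + m)" if "v \<in> carrier_vec (n + m)" for v
    using that by (intro eq_vecI) (auto simp: signature_def scalar_prod_def)
  then show ?thesis
    by (simp add: dissipative_def)
qed

lemma add_in_dissipative:
  assumes R: "R \<in> dissipative n m" and S: "S \<in> dissipative n m"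
  shows "R + S \<in> dissipative n m"
proof -
  have c: "R \<in> carrier_mat (n + m) (n + m)" "S \<in> carrier_mat (n + m) (n + m)"
    using assms by (auto dest: dissipative_carrier)
  have "(signature n m *\<^sub>v ((R + S) *\<^sub>v v)) \<bullet>c v =
      (signature n m *\<^sub>v (R *\<^sub>v v)) \<bullet>c v + (signature n m *\<^sub>v (S *\<^sub>v v)) \<bullet>c v"
    if v: "v \<in> carrier_vec (n + m)" for v
    using c v
    by (simp add: add_mult_distrib_mat_vec[OF c v] mult_add_distrib_mat_vec[OF signature_carrier]
        add_scalar_prod_distrib[OF signature_mult_vec_carrier signature_mult_vec_carrier])
  then show ?thesis
    using c dissipativeD[OF R] dissipativeD[OF S] by (simp add: dissipative_def)
qed

text \<open>The signature is a scalar on each of the two blocks, so it commutes with everything that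
  preserves them; an off-diagonal block would change sign instead. The adjoint form is the one that
  a congruence meets on its left side.\<close>

lemma block_diag_commutes_signature:
  fixes A D :: "complex mat"
  assumes "A \<in> carrier_mat n n" "D \<in> carrier_mat m m"
  defines "T \<equiv> four_block_mat A (0\<^sub>m n m) (0\<^sub>m m n) D"
  shows "signature n m * mat_adjoint T = mat_adjoint T * signature n m"
proof -
  have Tc: "T \<in> carrier_mat (n + m) (n + m)"
    using assms by (simp add: T_def)
  have "signature n m * T = four_block_mat (- A) (0\<^sub>m n m) (0\<^sub>m m n) D"
    unfolding signature_def T_def
    by (subst mult_four_block_mat[where ?nr1.0=n and ?n1.0=n and ?n2.0=m and ?nr2.0=m and ?nc1.0=n and ?nc2.0=m])
      (use assms in auto)
  moreover have "T * signature n m = four_block_mat (- A) (0\<^sub>m n m) (0\<^sub>m m n) D"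
    unfolding signature_def T_def
    by (subst mult_four_block_mat[where ?nr1.0=n and ?n1.0=n and ?n2.0=m and ?nr2.0=m and ?nc1.0=n and ?nc2.0=m])
      (use assms in auto)
  ultimately have "mat_adjoint (signature n m * T) = mat_adjoint (T * signature n m)"
    by simp
  then show ?thesis
    by (simp add: mat_adjoint_mult[OF signature_carrier Tc] mat_adjoint_mult[OF Tc signature_carrier])
qed

lemma congruence_in_dissipative:
  assumes R: "R \<in> dissipative n m" and A: "A \<in> carrier_mat n n" and D: "D \<in> carrier_mat m m"
  defines "T \<equiv> four_block_mat A (0\<^sub>m n m) (0\<^sub>m m n) D"
  shows "mat_adjoint T * R * T \<in> dissipative n m"
proof -
  have Rc: "R \<in> carrier_mat (n + m) (n + m)" by (rule dissipative_carrier[OF R])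
  have Tc: "T \<in> carrier_mat (n + m) (n + m)" using A D by (simp add: T_def)
  have Tc': "mat_adjoint T \<in> carrier_mat (n + m) (n + m)" by (rule mat_adjoint_carrier[OF Tc])
  have "0 \<le> Re ((signature n m *\<^sub>v ((mat_adjoint T * R * T) *\<^sub>v v)) \<bullet>c v)"
    if v: "v \<in> carrier_vec (n + m)" for v
  proof -
    have Tv: "T *\<^sub>v v \<in> carrier_vec (n + m)" using Tc v by simp
    have RTv: "R *\<^sub>v (T *\<^sub>v v) \<in> carrier_vec (n + m)" using Rc Tv by simp
    have "(mat_adjoint T * R * T) *\<^sub>v v = mat_adjoint T *\<^sub>v (R *\<^sub>v (T *\<^sub>v v))"
      by (simp only: assoc_mult_mat_vec[OF mult_carrier_mat[OF Tc' Rc] Tc v]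
          assoc_mult_mat_vec[OF Tc' Rc Tv])
    then have "signature n m *\<^sub>v ((mat_adjoint T * R * T) *\<^sub>v v)
        = (signature n m * mat_adjoint T) *\<^sub>v (R *\<^sub>v (T *\<^sub>v v))"
      by (simp only: assoc_mult_mat_vec[OF signature_carrier Tc' RTv])
    also have "\<dots> = mat_adjoint T *\<^sub>v (signature n m *\<^sub>v (R *\<^sub>v (T *\<^sub>v v)))"
      by (simp only: block_diag_commutes_signature[OF A D, folded T_def]
          assoc_mult_mat_vec[OF Tc' signature_carrier RTv])
    also have "\<dots> \<bullet>c v = (signature n m *\<^sub>v (R *\<^sub>v (T *\<^sub>v v))) \<bullet>c (T *\<^sub>v v)"
      using cscalar_prod_mat_adjoint[OF Tc' signature_mult_vec_carrier v] by simp
    finally show ?thesis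
      using dissipativeD[OF R Tv] by simp
  qed
  then show ?thesis
    using Rc Tc Tc' by (simp add: dissipative_def)
qed

lemma inverse_in_dissipative:
  assumes R: "R \<in> dissipative n m" and S: "S \<in> carrier_mat (n + m) (n + m)"
    and RS: "R * S = 1\<^sub>m (n + m)"
  shows "S \<in> dissipative n m"
proof -
  have Rc: "R \<in> carrier_mat (n + m) (n + m)" by (rule dissipative_carrier[OF R])
  have "0 \<le> Re ((signature n m *\<^sub>v (S *\<^sub>v v)) \<bullet>c v)" if v: "v \<in> carrier_vec (n + m)" for v
  proof -
    define w where "w = S *\<^sub>v v"
    have w: "w \<in> carrier_vec (n + m)" using S v by (simp add: w_def)
    have Rw: "R *\<^sub>v w = v"
      unfolding w_def using assoc_mult_mat_vec[OF Rc S v] RS v by simp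
    \<comment> \<open>As \<open>v = R w\<close>, moving the Hermitian signature to the other side
      and using the symmetry of the real part turns the form of \<open>R\<close> at \<open>w\<close>
      into the form of \<open>S\<close> at \<open>v\<close>.\<close>
    have "(signature n m *\<^sub>v v) \<bullet>c w = v \<bullet>c (signature n m *\<^sub>v w)"
      using cscalar_prod_mat_adjoint[OF signature_carrier v w] by simp
    then have "Re ((signature n m *\<^sub>v v) \<bullet>c w) = Re ((signature n m *\<^sub>v w) \<bullet>c v)"
      using Re_cscalar_prod_commute[OF v signature_mult_vec_carrier, of w] by simp
    then show ?thesis
      using dissipativeD[OF R w] unfolding Rw by (simp add: w_def)
  qed
  then show ?thesis
    using S by (simp add: dissipative_def)
qed

section \<open>Inverses of matrices over a field\<close>

lemma the_mat_inverse:
  fixes A :: "'a :: field mat"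
  assumes A: "A \<in> carrier_mat n n" and det: "det A \<noteq> 0"
  shows "the (mat_inverse A) \<in> carrier_mat n n"
    and "A * the (mat_inverse A) = 1\<^sub>m n" and "the (mat_inverse A) * A = 1\<^sub>m n"
proof -
  have "A \<in> Units (ring_mat TYPE('a) n ())"
    by (rule det_non_zero_imp_unit[OF A det])
  then obtain B where "mat_inverse A = Some B"
    using mat_inverse(1)[OF A, where b = "()"] by fastforce
  then show "the (mat_inverse A) \<in> carrier_mat n n"
    "A * the (mat_inverse A) = 1\<^sub>m n" "the (mat_inverse A) * A = 1\<^sub>m n"
    using mat_inverse(2)[OF A] by auto
qed

lemma invertible_mat_imp_det_nonzero:
  fixes A :: "'a :: field mat"
  assumes A: "A \<in> carrier_mat n n" and inv: "invertible_mat A"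
  shows "det A \<noteq> 0"
proof -
  obtain B where B: "A * B = 1\<^sub>m n" "B * A = 1\<^sub>m (dim_row B)"
    using inv A by (auto simp: invertible_mat_def inverts_mat_def)
  \<comment> \<open>\<open>invertible_mat\<close> does not fix the size of the inverse; it is read
    off from the column counts of the two products.\<close>
  have "B \<in> carrier_mat n n"
    using arg_cong[OF B(1), of dim_col] arg_cong[OF B(2), of dim_col] A by auto
  then show ?thesis
    using det_mult[OF A, of B] B(1) by (metis det_one mult_zero_left zero_neq_one)
qed

section \<open>Transfer functions\<close>

lemma num_mult_den_Fract:
  assumes "q \<noteq> 0"
  shows "num (Fract p q) * q = p * den (Fract p q)"
proof -
  have "Fract (num (Fract p q)) (den (Fract p q)) = Fract p q"
    by (simp add: num_def den_def)
  then show ?thesis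
    using eq_fract(1)[of "den (Fract p q)" q "num (Fract p q)" p] assms by (simp add: den_def)
qed

text \<open>After cross-multiplication the reduced denominator divides
  \<open>num (Fract p q) * q\<close>, and it is coprime to the first factor. Hence reduction can
  remove poles but never create one.\<close>

lemma den_Fract_dvd:
  assumes "q \<noteq> 0"
  shows "den (Fract p q) dvd q"
proof -
  have "den (Fract p q) dvd num (Fract p q) * q"
    by (simp add: num_mult_den_Fract[OF assms])
  moreover have "coprime (den (Fract p q)) (num (Fract p q))"
    using coprime_quot_of_fract[of "Fract p q"] by (simp add: num_def den_def coprime_commute)
  ultimately show ?thesis
    by (simp add: coprime_dvd_mult_right_iff)
qed

text \<open>Reduction keeps the difference of the degrees, by cross-multiplication. The zero
  numerator is treated separately because degrees add only for nonzero polynomials.\<close>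

lemma degree_num_le_den_Fract:
  assumes "q \<noteq> 0" and "degree p \<le> degree q"
  shows "degree (num (Fract p q)) \<le> degree (den (Fract p q))"
proof (cases "num (Fract p q) = 0")
  case False
  have d: "den (Fract p q) \<noteq> 0" by (simp add: den_def)
  have "p \<noteq> 0"
    using num_mult_den_Fract[OF assms(1), of p] False assms(1) by auto
  then show ?thesis
    using arg_cong[OF num_mult_den_Fract[OF assms(1), of p], of degree] False d assms
    by (simp add: degree_mult_eq)
qed simp

lemma poly_num_div_den_Fract:
  assumes "poly q s \<noteq> 0"
  shows "poly (den (Fract p q)) s \<noteq> 0"
    and "poly (num (Fract p q)) s / poly (den (Fract p q)) s = poly p s / poly q s"
proof -
  have q: "q \<noteq> 0" using assms by auto
  show d: "poly (den (Fract p q)) s \<noteq> 0"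
    using den_Fract_dvd[OF q, of p] assms by (metis dvd_trans poly_eq_0_iff_dvd)
  show "poly (num (Fract p q)) s / poly (den (Fract p q)) s = poly p s / poly q s"
    using arg_cong[OF num_mult_den_Fract[OF q, of p], of "\<lambda>r. poly r s"] d assms
    by (simp add: field_simps)
qed

section \<open>The transfer function as a matrix of fractions\<close>

text \<open>Cramer's rule: the resolvent is the adjugate of \<open>char_poly_matrix A\<close>
  divided by \<open>char_poly A\<close>. This is the numerator of \<open>F\<close> over that common
  denominator, in general not in lowest terms.\<close>

definition transfer_numerator ::
  "complex mat \<Rightarrow> complex mat \<Rightarrow> complex mat \<Rightarrow> complex mat \<Rightarrow> complex poly mat" where
  "transfer_numerator A B C D =
     map_mat (\<lambda>a. [:a:]) C * adj_mat (char_poly_matrix A) * map_mat (\<lambda>a. [:a:]) B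
       + char_poly A \<cdot>\<^sub>m map_mat (\<lambda>a. [:a:]) D"

definition transfer_function ::
  "complex mat \<Rightarrow> complex mat \<Rightarrow> complex mat \<Rightarrow> complex mat \<Rightarrow> rational_mat" where
  "transfer_function A B C D = map_mat (\<lambda>p. Fract p (char_poly A)) (transfer_numerator A B C D)"

lemmas map_mat_poly_mult = semiring_hom.mat_hom_mult[OF poly_hom.semiring_hom_axioms]

lemma eval_char_poly_matrix:
  assumes "A \<in> carrier_mat n n"
  shows "map_mat (\<lambda>p. poly p s) (char_poly_matrix A) = s \<cdot>\<^sub>m 1\<^sub>m n - A"
  using assms by (intro eq_matI) (auto simp: char_poly_matrix_def)

lemma poly_char_poly:
  assumes "A \<in> carrier_mat n n"
  shows "poly (char_poly A) s = det (s \<cdot>\<^sub>m 1\<^sub>m n - A)"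
proof -
  show ?thesis
    using comm_ring_hom.hom_det[OF poly_hom.comm_ring_hom_axioms, of s "char_poly_matrix A"] eval_char_poly_matrix[OF assms, of s]
    by (simp add: char_poly_def)
qed

lemma char_poly_nonzero:
  fixes A :: "'a :: comm_ring_1 mat"
  assumes "A \<in> carrier_mat n n"
  shows "char_poly A \<noteq> 0"
  using degree_monic_char_poly[OF assms] by auto

text \<open>Evaluate the adjugate identity, which holds over the polynomials, at \<open>s\<close>
  and cancel the invertible factor. One polynomial matrix thus yields the resolvent at all regular
  points at once.\<close>

lemma eval_adj_char_poly_matrix:
  fixes A :: "'a :: field mat"
  assumes A: "A \<in> carrier_mat n n" and det: "det (s \<cdot>\<^sub>m 1\<^sub>m n - A) \<noteq> 0"
  shows "map_mat (\<lambda>p. poly p s) (adj_mat (char_poly_matrix A))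
    = det (s \<cdot>\<^sub>m 1\<^sub>m n - A) \<cdot>\<^sub>m the (mat_inverse (s \<cdot>\<^sub>m 1\<^sub>m n - A))" (is "?E = ?d \<cdot>\<^sub>m ?G")
proof -
  have X: "char_poly_matrix A \<in> carrier_mat n n" using A by simp
  have M: "s \<cdot>\<^sub>m 1\<^sub>m n - A \<in> carrier_mat n n" by (rule minus_carrier_mat[OF A])
  note G = the_mat_inverse[OF M det]
  have E: "?E \<in> carrier_mat n n" using adj_mat(1)[OF X] by simp
  have "(s \<cdot>\<^sub>m 1\<^sub>m n - A) * ?E = map_mat (\<lambda>p. poly p s) (char_poly_matrix A * adj_mat (char_poly_matrix A))"
    by (simp only: map_mat_poly_mult[OF X adj_mat(1)[OF X]] eval_char_poly_matrix[OF A])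
  also have "\<dots> = ?d \<cdot>\<^sub>m 1\<^sub>m n"
    unfolding adj_mat(2)[OF X] using poly_char_poly[OF A, of s]
    by (intro eq_matI) (auto simp: char_poly_def)
  finally have "?G * ((s \<cdot>\<^sub>m 1\<^sub>m n - A) * ?E) = ?G * (?d \<cdot>\<^sub>m 1\<^sub>m n)"
    by simp
  also have "?G * ((s \<cdot>\<^sub>m 1\<^sub>m n - A) * ?E) = ?E"
    using E by (simp add: assoc_mult_mat[OF G(1) M E, symmetric] G(3))
  also have "?G * (?d \<cdot>\<^sub>m 1\<^sub>m n) = ?d \<cdot>\<^sub>m ?G"
    using G(1) by (simp add: mult_smult_distrib[OF G(1) one_carrier_mat])
  finally show ?thesis .
qed

lemma eval_transfer_numerator:
  assumes A: "A \<in> carrier_mat n n" and B: "B \<in> carrier_mat n m"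
    and C: "C \<in> carrier_mat m n" and D: "D \<in> carrier_mat m m"
    and det: "det (s \<cdot>\<^sub>m 1\<^sub>m n - A) \<noteq> 0"
  shows "map_mat (\<lambda>p. poly p s) (transfer_numerator A B C D)
    = det (s \<cdot>\<^sub>m 1\<^sub>m n - A) \<cdot>\<^sub>m (C * the (mat_inverse (s \<cdot>\<^sub>m 1\<^sub>m n - A)) * B + D)"
    (is "?l = ?d \<cdot>\<^sub>m (C * ?G * B + D)")
proof -
  have adj: "adj_mat (char_poly_matrix A) \<in> carrier_mat n n"
    using A by (intro adj_mat(1)) simp
  have M: "s \<cdot>\<^sub>m 1\<^sub>m n - A \<in> carrier_mat n n" by (rule minus_carrier_mat[OF A])
  note G = the_mat_inverse[OF M det]
  have const: "map_mat (\<lambda>p. poly p s) (map_mat (\<lambda>a. [:a:]) Z) = Z" for Z :: "complex mat"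
    by (intro eq_matI) auto
  have C': "map_mat (\<lambda>a. [:a:]) C \<in> carrier_mat m n" and B': "map_mat (\<lambda>a. [:a:]) B \<in> carrier_mat n m"
    using B C by auto
  have "map_mat (\<lambda>p. poly p s) (map_mat (\<lambda>a. [:a:]) C * adj_mat (char_poly_matrix A) * map_mat (\<lambda>a. [:a:]) B)
      = C * (?d \<cdot>\<^sub>m ?G) * B"
    by (simp only: map_mat_poly_mult[OF mult_carrier_mat[OF C' adj] B'] map_mat_poly_mult[OF C' adj] const
        eval_adj_char_poly_matrix[OF A det])
  also have "\<dots> = ?d \<cdot>\<^sub>m (C * ?G * B)"
    by (simp only: mult_smult_distrib[OF C G(1)] mult_smult_assoc_mat[OF mult_carrier_mat[OF C G(1)] B])
  finally have 1: "map_mat (\<lambda>p. poly p s)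
      (map_mat (\<lambda>a. [:a:]) C * adj_mat (char_poly_matrix A) * map_mat (\<lambda>a. [:a:]) B)
      = ?d \<cdot>\<^sub>m (C * ?G * B)" .
  have "?l = map_mat (\<lambda>p. poly p s)
      (map_mat (\<lambda>a. [:a:]) C * adj_mat (char_poly_matrix A) * map_mat (\<lambda>a. [:a:]) B) + ?d \<cdot>\<^sub>m D"
    unfolding transfer_numerator_def using B C D adj poly_char_poly[OF A, of s]
    by (intro eq_matI) auto
  then show ?thesis
    unfolding 1 using B C D G(1) by (intro eq_matI) (auto simp: algebra_simps)
qed

lemma realizes_transfer_function:
  assumes A: "A \<in> carrier_mat n n" and B: "B \<in> carrier_mat n m"
    and C: "C \<in> carrier_mat m n" and D: "D \<in> carrier_mat m m"
  shows "realizes n m A B C D (transfer_function A B C D)"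
proof -
  have num: "transfer_numerator A B C D \<in> carrier_mat m m"
    using B C D by (simp add: transfer_numerator_def)
  have F: "transfer_function A B C D \<in> carrier_mat m m"
    using num by (simp add: transfer_function_def)
  have "\<not> has_pole (transfer_function A B C D) s \<and>
      value_at (transfer_function A B C D) s
        = C * the (mat_inverse (s \<cdot>\<^sub>m 1\<^sub>m n - A)) * B + D" (is "_ \<and> _ = ?V")
    if det: "det (s \<cdot>\<^sub>m 1\<^sub>m n - A) \<noteq> 0" for s
  proof
    have q: "poly (char_poly A) s \<noteq> 0" using det by (simp add: poly_char_poly[OF A])
    show "\<not> has_pole (transfer_function A B C D) s"
      using poly_num_div_den_Fract(1)[OF q] by (auto simp: has_pole_def transfer_function_def)
    have V: "?V \<in> carrier_mat m m" using B C D by simp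
    have "value_at (transfer_function A B C D) s
        = map_mat (\<lambda>p. poly p s / poly (char_poly A) s) (transfer_numerator A B C D)"
      using num poly_num_div_den_Fract(2)[OF q]
      by (intro eq_matI) (auto simp: value_at_def transfer_function_def)
    also have "\<dots> = map_mat (\<lambda>z. z / poly (char_poly A) s)
        (map_mat (\<lambda>p. poly p s) (transfer_numerator A B C D))"
      by (intro eq_matI) auto
    also have "\<dots> = ?V"
      unfolding eval_transfer_numerator[OF A B C D det]
      using V det by (intro eq_matI) (auto simp: poly_char_poly[OF A])
    finally show "value_at (transfer_function A B C D) s = ?V" .
  qed
  then show ?thesis
    using assms F by (simp add: realizes_def)
qed

section \<open>Degrees and the behaviour at infinity\<close>

text \<open>Up to sign an entry is a minor of size \<open>n - 1\<close> with entries of degree at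
  most 1. The cruder bound \<open>n\<close> suffices, because \<open>D\<close> is multiplied by
  \<open>char_poly A\<close>, which has degree \<open>n\<close> anyway.\<close>

lemma degree_adj_char_poly_matrix:
  fixes A :: "complex mat"
  assumes A: "A \<in> carrier_mat n n" and ij: "i < n" "j < n"
  shows "degree (adj_mat (char_poly_matrix A) $$ (i, j)) \<le> n"
proof -
  have X: "char_poly_matrix A \<in> carrier_mat n n" using A by simp
  have "degree (char_poly_matrix A $$ (k, l)) \<le> 1" if "k < n" "l < n" for k l
    using A that by (auto simp: char_poly_matrix_def)
  moreover have Y: "mat_delete (char_poly_matrix A) j i \<in> carrier_mat (n - 1) (n - 1)"
    using X by (simp add: mat_delete_def carrier_matD)
  ultimately have "degree (det (mat_delete (char_poly_matrix A) j i)) \<le> 1 * (n - 1)"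
    using X by (intro degree_det_le) (auto simp: mat_delete_def)
  moreover have "degree ((- 1) ^ (j + i) * p) \<le> degree p" for p :: "complex poly"
    by (cases "even (j + i)") auto
  ultimately show ?thesis
    using X ij by (auto simp: adj_mat_def cofactor_def intro: order.trans[OF order.trans diff_le_self])
qed

lemma degree_mult_mat_le:
  fixes P Q :: "'a :: comm_semiring_0 poly mat"
  assumes P: "P \<in> carrier_mat nr n" and Q: "Q \<in> carrier_mat n nc"
    and "\<And>i k. i < nr \<Longrightarrow> k < n \<Longrightarrow> degree (P $$ (i, k)) \<le> a"
    and "\<And>k j. k < n \<Longrightarrow> j < nc \<Longrightarrow> degree (Q $$ (k, j)) \<le> b"
    and ij: "i < nr" "j < nc"
  shows "degree ((P * Q) $$ (i, j)) \<le> a + b"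
proof -
  have "(P * Q) $$ (i, j) = (\<Sum>k = 0..<n. P $$ (i, k) * Q $$ (k, j))"
    using P Q ij by (simp add: scalar_prod_def)
  also have "degree \<dots> \<le> a + b"
    using assms by (intro degree_sum_le) (auto intro!: order.trans[OF degree_mult_le] add_mono)
  finally show ?thesis .
qed

lemma no_pole_at_infinity_transfer_function:
  assumes A: "A \<in> carrier_mat n n" and B: "B \<in> carrier_mat n m"
    and C: "C \<in> carrier_mat m n" and D: "D \<in> carrier_mat m m"
  shows "no_pole_at_infinity (transfer_function A B C D)"
proof -
  have X: "adj_mat (char_poly_matrix A) \<in> carrier_mat n n"
    using A by (intro adj_mat(1)) simp
  have deg: "degree (char_poly A) = n"
    using degree_monic_char_poly[OF A] by simp
  have "degree (transfer_numerator A B C D $$ (i, j)) \<le> n" if ij: "i < m" "j < m" for i j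
  proof -
    have C': "map_mat (\<lambda>a. [:a:]) C \<in> carrier_mat m n"
      and B': "map_mat (\<lambda>a. [:a:]) B \<in> carrier_mat n m"
      using B C by auto
    have "degree ((map_mat (\<lambda>a. [:a:]) C * adj_mat (char_poly_matrix A)) $$ (k, l)) \<le> 0 + n"
      if "k < m" "l < n" for k l
      by (rule degree_mult_mat_le[OF C' X _ degree_adj_char_poly_matrix[OF A] that]) (use C in auto)
    then have "degree ((map_mat (\<lambda>a. [:a:]) C * adj_mat (char_poly_matrix A)
        * map_mat (\<lambda>a. [:a:]) B) $$ (i, j)) \<le> n + 0"
      by (intro degree_mult_mat_le[OF mult_carrier_mat[OF C' X] B' _ _ ij]) (use B in auto)
    moreover have "transfer_numerator A B C D $$ (i, j)
        = (map_mat (\<lambda>a. [:a:]) C * adj_mat (char_poly_matrix A) * map_mat (\<lambda>a. [:a:]) B) $$ (i, j)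
          + char_poly A * [:D $$ (i, j):]"
      using X B C D ij by (simp add: transfer_numerator_def del: index_mult_mat(1))
    moreover have "degree (char_poly A * [:D $$ (i, j):]) \<le> n"
      using deg by (auto intro: order.trans[OF degree_smult_le])
    ultimately show ?thesis
      by (simp add: degree_add_le del: index_mult_mat(1))
  qed
  moreover have "transfer_numerator A B C D \<in> carrier_mat m m"
    using B C D by (simp add: transfer_numerator_def)
  ultimately show ?thesis
    unfolding no_pole_at_infinity_def transfer_function_def
    using degree_num_le_den_Fract[OF char_poly_nonzero[OF A]] deg
    by (auto dest!: elements_matD)
qed

section \<open>State equations at a fixed frequency\<close>

lemma resolvent_mult_vec:
  fixes A :: "'a :: comm_ring_1 mat"
  assumes A: "A \<in> carrier_mat n n" and x: "x \<in> carrier_vec n"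
  shows "(s \<cdot>\<^sub>m 1\<^sub>m n - A) *\<^sub>v x = s \<cdot>\<^sub>v x - A *\<^sub>v x"
proof -
  have "(s \<cdot>\<^sub>m 1\<^sub>m n) *\<^sub>v x = s \<cdot>\<^sub>v x"
    using x by (intro eq_vecI) (auto simp: row_smult[of _ "1\<^sub>m n"])
  then show ?thesis
    using minus_mult_distrib_mat_vec[of "s \<cdot>\<^sub>m 1\<^sub>m n" n n A x] A x by simp
qed

text \<open>The left side is the system x' = A x + B u for signals proportional to e^(st), written
  for their amplitudes. Collecting the terms in \<open>x\<close> gives a linear system with the
  matrix of the resolvent.\<close>

lemma state_equation_iff:
  fixes A :: "complex mat"
  assumes A: "A \<in> carrier_mat n n" and B: "B \<in> carrier_mat n m"
    and det: "det (s \<cdot>\<^sub>m 1\<^sub>m n - A) \<noteq> 0"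
    and x: "x \<in> carrier_vec n" and u: "u \<in> carrier_vec m"
  shows "A *\<^sub>v x + B *\<^sub>v u = s \<cdot>\<^sub>v x \<longleftrightarrow> x = the (mat_inverse (s \<cdot>\<^sub>m 1\<^sub>m n - A)) *\<^sub>v (B *\<^sub>v u)"
    (is "_ \<longleftrightarrow> x = ?G *\<^sub>v _")
proof -
  have M: "s \<cdot>\<^sub>m 1\<^sub>m n - A \<in> carrier_mat n n" by (rule minus_carrier_mat[OF A])
  note G = the_mat_inverse[OF M det]
  have Bu: "B *\<^sub>v u \<in> carrier_vec n" using B u by simp
  have "A *\<^sub>v x + B *\<^sub>v u = s \<cdot>\<^sub>v x \<longleftrightarrow> s \<cdot>\<^sub>v x - A *\<^sub>v x = B *\<^sub>v u"
    (is "?l \<longleftrightarrow> ?r")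
  proof
    assume ?l
    show ?r unfolding \<open>?l\<close>[symmetric] using carrier_matD[OF A] carrier_vecD[OF Bu] carrier_vecD[OF x]
      by (intro eq_vecI) auto
  next
    assume ?r
    show ?l unfolding \<open>?r\<close>[symmetric] using carrier_matD[OF A] carrier_vecD[OF x]
      by (intro eq_vecI) auto
  qed
  also have "\<dots> \<longleftrightarrow> (s \<cdot>\<^sub>m 1\<^sub>m n - A) *\<^sub>v x = B *\<^sub>v u"
    by (simp only: resolvent_mult_vec[OF A x])
  also have "\<dots> \<longleftrightarrow> x = ?G *\<^sub>v (B *\<^sub>v u)"
    using assoc_mult_mat_vec[OF G(1) M x] assoc_mult_mat_vec[OF M G(1) Bu] G(2,3) x Bu
    by (metis one_mult_mat_vec)
  finally show ?thesis .
qed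

lemma ex_state:
  fixes A :: "complex mat"
  assumes A: "A \<in> carrier_mat n n" and B: "B \<in> carrier_mat n m"
    and det: "det (s \<cdot>\<^sub>m 1\<^sub>m n - A) \<noteq> 0" and u: "u \<in> carrier_vec m"
  obtains x where "x \<in> carrier_vec n" and "A *\<^sub>v x + B *\<^sub>v u = s \<cdot>\<^sub>v x"
proof -
  have "the (mat_inverse (s \<cdot>\<^sub>m 1\<^sub>m n - A)) \<in> carrier_mat n n"
    using A det by (intro the_mat_inverse) auto
  then have "the (mat_inverse (s \<cdot>\<^sub>m 1\<^sub>m n - A)) *\<^sub>v (B *\<^sub>v u) \<in> carrier_vec n"
    using B u by simp
  then show ?thesis
    using that state_equation_iff[OF A B det _ u] by blast
qed

text \<open>This replaces the resolvent formula by a pair of vectors \<open>x\<close>,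
  \<open>u\<close> to which the whole array can be applied, as both the dissipation inequality and
  the inverse array require.\<close>

lemma value_at_mult_vec:
  assumes r: "realizes n m A B C D F" and det: "det (s \<cdot>\<^sub>m 1\<^sub>m n - A) \<noteq> 0"
    and x: "x \<in> carrier_vec n" and u: "u \<in> carrier_vec m"
    and eq: "A *\<^sub>v x + B *\<^sub>v u = s \<cdot>\<^sub>v x"
  shows "value_at F s *\<^sub>v u = C *\<^sub>v x + D *\<^sub>v u"
proof -
  have c: "A \<in> carrier_mat n n" "B \<in> carrier_mat n m" "C \<in> carrier_mat m n" "D \<in> carrier_mat m m"
    and V: "value_at F s = C * the (mat_inverse (s \<cdot>\<^sub>m 1\<^sub>m n - A)) * B + D"
    using r det by (auto simp: realizes_def)
  have G: "the (mat_inverse (s \<cdot>\<^sub>m 1\<^sub>m n - A)) \<in> carrier_mat n n" (is "?G \<in> _")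
    using c det by (intro the_mat_inverse) auto
  have Bu: "B *\<^sub>v u \<in> carrier_vec n" using c u by simp
  have "value_at F s *\<^sub>v u = (C * ?G * B) *\<^sub>v u + D *\<^sub>v u"
    unfolding V using c G u by (intro add_mult_distrib_mat_vec[of _ m m]) auto
  also have "(C * ?G * B) *\<^sub>v u = C *\<^sub>v (?G *\<^sub>v (B *\<^sub>v u))"
    by (simp only: assoc_mult_mat_vec[OF mult_carrier_mat[OF c(3) G] c(2) u]
        assoc_mult_mat_vec[OF c(3) G Bu])
  also have "?G *\<^sub>v (B *\<^sub>v u) = x"
    using state_equation_iff[OF c(1,2) det x u] eq by simp
  finally show ?thesis .
qed

section \<open>Dissipation and positivity\<close>

lemma signature_mult_append:
  assumes "a \<in> carrier_vec n" and "b \<in> carrier_vec m"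
  shows "signature n m *\<^sub>v (a @\<^sub>v b) = - a @\<^sub>v b"
  unfolding signature_def
  by (subst four_block_mat_mult_vec[of _ n n _ m _ m]) (use assms in auto)

lemma cscalar_prod_append:
  fixes a b x u :: "complex vec"
  assumes "a \<in> carrier_vec n" and "b \<in> carrier_vec m" and "x \<in> carrier_vec n" and "u \<in> carrier_vec m"
  shows "(a @\<^sub>v b) \<bullet>c (x @\<^sub>v u) = a \<bullet>c x + b \<bullet>c u"
proof -
  have "conjugate (x @\<^sub>v u) = conjugate x @\<^sub>v conjugate u"
    by (intro eq_vecI) auto
  then show ?thesis
    using assms by (simp add: scalar_prod_append[of _ n _ m])
qed

text \<open>Passivity: the growth of the stored energy is bounded by the supplied power. It comes
  from testing the array on the joined vector of \<open>x\<close> and \<open>u\<close>. It is stated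
  for a solution of the state equation instead of through the resolvent, so that it also applies at
  eigenvalues of \<open>A\<close>.\<close>

lemma dissipation_inequality:
  assumes R: "four_block_mat A B C D \<in> dissipative n m"
    and c: "A \<in> carrier_mat n n" "B \<in> carrier_mat n m" "C \<in> carrier_mat m n" "D \<in> carrier_mat m m"
    and x: "x \<in> carrier_vec n" and u: "u \<in> carrier_vec m"
    and eq: "A *\<^sub>v x + B *\<^sub>v u = s \<cdot>\<^sub>v x"
  shows "Re s * Re (x \<bullet>c x) \<le> Re ((C *\<^sub>v x + D *\<^sub>v u) \<bullet>c u)"
proof -
  have y: "C *\<^sub>v x + D *\<^sub>v u \<in> carrier_vec m" using c x u by simp
  have sx: "s \<cdot>\<^sub>v x \<in> carrier_vec n" using x by simp
  have "four_block_mat A B C D *\<^sub>v (x @\<^sub>v u) = s \<cdot>\<^sub>v x @\<^sub>v (C *\<^sub>v x + D *\<^sub>v u)"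
    by (simp only: four_block_mat_mult_vec[OF c x u] eq)
  then have "0 \<le> Re ((- (s \<cdot>\<^sub>v x) @\<^sub>v (C *\<^sub>v x + D *\<^sub>v u)) \<bullet>c (x @\<^sub>v u))"
    using dissipativeD[OF R append_carrier_vec[OF x u]] by (simp add: signature_mult_append[OF sx y])
  also have "(- (s \<cdot>\<^sub>v x) @\<^sub>v (C *\<^sub>v x + D *\<^sub>v u)) \<bullet>c (x @\<^sub>v u)
      = - (s * (x \<bullet>c x)) + (C *\<^sub>v x + D *\<^sub>v u) \<bullet>c u"
    using x by (simp add: cscalar_prod_append[OF uminus_carrier_vec[THEN iffD2, OF sx] y x u])
  finally have "Re (s * (x \<bullet>c x)) \<le> Re ((C *\<^sub>v x + D *\<^sub>v u) \<bullet>c u)"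
    by simp
  \<comment> \<open>The real part of the product with the complex number \<open>s\<close> splits
    because the squared norm is real.\<close>
  moreover have "Im (x \<bullet>c x) = 0"
    using conjugate_square_ge_0_vec[of x] by (simp add: less_eq_complex_def)
  ultimately show ?thesis
    by simp
qed

lemma Re_cscalar_prod_self:
  fixes x :: "complex vec"
  assumes "x \<in> carrier_vec n"
  shows "0 \<le> Re (x \<bullet>c x)" and "x \<noteq> 0\<^sub>v n \<Longrightarrow> 0 < Re (x \<bullet>c x)"
  using conjugate_square_ge_0_vec[of x] conjugate_square_greater_0_vec[OF assms]
  by (auto simp: less_eq_complex_def less_complex_def)

text \<open>An eigenvector is a state with zero input. No power is supplied, so its energy cannot
  grow. Hence the resolvent formula holds on the whole open right half plane.\<close>

lemma dissipative_no_eigenvalue_right_half_plane: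
  assumes R: "four_block_mat A B C D \<in> dissipative n m"
    and c: "A \<in> carrier_mat n n" "B \<in> carrier_mat n m" "C \<in> carrier_mat m n" "D \<in> carrier_mat m m"
    and s: "0 < Re s"
  shows "det (s \<cdot>\<^sub>m 1\<^sub>m n - A) \<noteq> 0"
proof
  assume "det (s \<cdot>\<^sub>m 1\<^sub>m n - A) = 0"
  then obtain x where x: "x \<in> carrier_vec n" "x \<noteq> 0\<^sub>v n" "(s \<cdot>\<^sub>m 1\<^sub>m n - A) *\<^sub>v x = 0\<^sub>v n"
    using det_0_iff_vec_prod_zero[OF minus_carrier_mat[OF c(1)]] by blast
  have Ax: "A *\<^sub>v x \<in> carrier_vec n" using c x by simp
  have z: "s \<cdot>\<^sub>v x - A *\<^sub>v x = 0\<^sub>v n"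
    using x(3) by (simp add: resolvent_mult_vec[OF c(1) x(1)])
  have "A *\<^sub>v x + B *\<^sub>v 0\<^sub>v m = A *\<^sub>v x + (s \<cdot>\<^sub>v x - A *\<^sub>v x)"
    unfolding z using c by (intro eq_vecI) auto
  also have "\<dots> = s \<cdot>\<^sub>v x"
    using carrier_matD[OF c(1)] carrier_vecD[OF x(1)] by (intro eq_vecI) auto
  finally have "Re s * Re (x \<bullet>c x) \<le> Re ((C *\<^sub>v x + D *\<^sub>v 0\<^sub>v m) \<bullet>c 0\<^sub>v m)"
    by (intro dissipation_inequality[OF R c x(1)]) simp_all
  also have "\<dots> = 0"
    using c x by (simp add: scalar_prod_right_zero[of _ m])
  finally show False
    using s Re_cscalar_prod_self(2)[OF x(1,2)] by (simp add: mult_le_0_iff)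
qed

lemma dissipative_imp_positive:
  assumes R: "four_block_mat A B C D \<in> dissipative n m" and r: "realizes n m A B C D F"
  shows "positive m F"
proof -
  have c: "A \<in> carrier_mat n n" "B \<in> carrier_mat n m" "C \<in> carrier_mat m n" "D \<in> carrier_mat m m"
    and F: "F \<in> carrier_mat m m"
    using r by (auto simp: realizes_def)
  have V: "value_at F s \<in> carrier_mat m m" for s
    using F by (simp add: value_at_def)
  have "value_at F s + mat_adjoint (value_at F s) \<in> psd_mats m" if s: "0 < Re s" for s
    unfolding add_mat_adjoint_in_psd_mats_iff[OF V]
  proof
    fix u :: "complex vec" assume u: "u \<in> carrier_vec m"
    have det: "det (s \<cdot>\<^sub>m 1\<^sub>m n - A) \<noteq> 0"
      by (rule dissipative_no_eigenvalue_right_half_plane[OF R c s])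
    obtain x where x: "x \<in> carrier_vec n" and eq: "A *\<^sub>v x + B *\<^sub>v u = s \<cdot>\<^sub>v x"
      by (rule ex_state[OF c(1,2) det u])
    have "0 \<le> Re s * Re (x \<bullet>c x)"
      using s Re_cscalar_prod_self(1)[OF x] by simp
    also have "\<dots> \<le> Re ((value_at F s *\<^sub>v u) \<bullet>c u)"
      using dissipation_inequality[OF R c x u eq] by (simp add: value_at_mult_vec[OF r det x u eq])
    finally show "0 \<le> Re ((value_at F s *\<^sub>v u) \<bullet>c u)" .
  qed
  then show ?thesis
    using F by (simp add: positive_def)
qed

lemma transfer_function_in_positive_functions:
  assumes R: "four_block_mat A B C D \<in> dissipative n m"
    and c: "A \<in> carrier_mat n n" "B \<in> carrier_mat n m" "C \<in> carrier_mat m n" "D \<in> carrier_mat m m"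
  shows "transfer_function A B C D \<in> positive_functions n m"
proof -
  have r: "realizes n m A B C D (transfer_function A B C D)"
    by (rule realizes_transfer_function[OF c])
  then have "mcmillan_degree m (transfer_function A B C D) \<le> n"
    unfolding mcmillan_degree_def by (intro Least_le) blast
  then show ?thesis
    using dissipative_imp_positive[OF R r] no_pole_at_infinity_transfer_function[OF c]
    by (simp add: positive_functions_def)
qed

lemma realization_arrays_subset_dissipative: "realization_arrays n m \<F> \<subseteq> dissipative n m"
proof
  fix R assume "R \<in> realization_arrays n m \<F>"
  then obtain A B C D F where "realizes n m A B C D F" and R: "R = four_block_mat A B C D"
    and Q: "signature n m * R + mat_adjoint R * signature n m \<in> psd_mats (n + m)"
    by (auto simp: realization_arrays_def)
  then have "R \<in> carrier_mat (n + m) (n + m)"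
    by (auto simp: realizes_def)
  then show "R \<in> dissipative n m"
    using Q by (simp add: dissipative_iff)
qed

lemma dissipative_blocks:
  assumes "R \<in> dissipative n m"
  obtains A B C D where "R = four_block_mat A B C D"
    and "A \<in> carrier_mat n n" "B \<in> carrier_mat n m" "C \<in> carrier_mat m n" "D \<in> carrier_mat m m"
proof -
  obtain A B C D where "split_block R n n = (A, B, C, D)"
    by (metis prod_cases4)
  from split_block[OF this, of m m] show ?thesis
    using dissipative_carrier[OF assms] that by auto
qed

lemma four_block_mat_in_realization_arrays:
  assumes R: "four_block_mat A B C D \<in> dissipative n m" and r: "realizes n m A B C D F"
    and F: "F \<in> \<F>"
  shows "four_block_mat A B C D \<in> realization_arrays n m \<F>"
  using F r R[unfolded dissipative_iff[OF dissipative_carrier[OF R]]]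
  unfolding realization_arrays_def by blast

lemma realization_arrays_positive_functions:
  "realization_arrays n m (positive_functions n m) = dissipative n m"
proof (rule antisym[OF realization_arrays_subset_dissipative], rule subsetI)
  fix R assume R: "R \<in> dissipative n m"
  obtain A B C D where eq: "R = four_block_mat A B C D"
    and c: "A \<in> carrier_mat n n" "B \<in> carrier_mat n m" "C \<in> carrier_mat m n" "D \<in> carrier_mat m m"
    by (rule dissipative_blocks[OF R])
  show "R \<in> realization_arrays n m (positive_functions n m)"
    using R unfolding eq
    by (intro four_block_mat_in_realization_arrays[OF _ realizes_transfer_function[OF c]]
        transfer_function_in_positive_functions[OF _ c]) auto
qed

section \<open>Realness\<close>

interpretation cnj_hom: comm_ring_hom cnj
  by unfold_locales auto

lemma real_mats_iff: "M \<in> real_mats \<longleftrightarrow> (\<forall>i < dim_row M. \<forall>j < dim_col M. M $$ (i, j) \<in> \<real>)"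
  unfolding real_mats_def elements_mat_def by force

text \<open>Real matrices are the fixed points of a ring homomorphism, which gives closure under
  products and inverses without computing entries.\<close>

lemma real_mats_iff_cnj: "M \<in> real_mats \<longleftrightarrow> map_mat cnj M = M"
  by (auto simp: real_mats_iff mat_eq_iff Reals_cnj_iff)

lemma mult_in_real_mats:
  assumes "A \<in> carrier_mat nr n" "B \<in> carrier_mat n nc" "A \<in> real_mats" "B \<in> real_mats"
  shows "A * B \<in> real_mats"
  using assms by (simp add: real_mats_iff_cnj cnj_hom.mat_hom_mult)

lemma add_in_real_mats:
  assumes "A \<in> carrier_mat nr nc" "B \<in> carrier_mat nr nc" "A \<in> real_mats" "B \<in> real_mats"
  shows "A + B \<in> real_mats"
  using assms by (auto simp: real_mats_iff)

lemma mat_adjoint_in_real_mats: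
  assumes "A \<in> real_mats"
  shows "mat_adjoint A \<in> real_mats"
  using assms by (auto simp: real_mats_iff complex_is_Real_iff)

text \<open>The conjugate of \<open>W\<close> is also a left inverse of the real matrix
  \<open>V\<close>, and the inverse of a square matrix is unique.\<close>

lemma left_inverse_in_real_mats:
  assumes V: "V \<in> carrier_mat k k" and W: "W \<in> carrier_mat k k"
    and WV: "W * V = 1\<^sub>m k" and real: "V \<in> real_mats"
  shows "W \<in> real_mats"
proof -
  have "map_mat cnj W * V = map_mat cnj (W * V)"
    using real by (simp add: cnj_hom.mat_hom_mult[OF W V] real_mats_iff_cnj)
  then have *: "map_mat cnj W * V = 1\<^sub>m k"
    by (simp add: WV cnj_hom.mat_hom_one)
  have VW: "V * W = 1\<^sub>m k"
    by (rule mat_mult_left_right_inverse[OF W V WV])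
  have "map_mat cnj W = map_mat cnj W * V * W"
    using W by (simp add: assoc_mult_mat[of _ k k _ k _ k, OF _ V W] VW)
  then show ?thesis
    using W by (simp add: * real_mats_iff_cnj)
qed

lemma the_mat_inverse_in_real_mats:
  assumes "A \<in> carrier_mat n n" "det A \<noteq> 0" "A \<in> real_mats"
  shows "the (mat_inverse A) \<in> real_mats"
  using left_inverse_in_real_mats[OF assms(1) the_mat_inverse(1)[OF assms(1,2)]]
    the_mat_inverse(3)[OF assms(1,2)] assms(3) by simp

lemma four_block_mat_in_real_matsD:
  assumes c: "A \<in> carrier_mat n n" "B \<in> carrier_mat n m" "C \<in> carrier_mat m n" "D \<in> carrier_mat m m"
    and R: "four_block_mat A B C D \<in> real_mats"
  shows "A \<in> real_mats" "B \<in> real_mats" "C \<in> real_mats" "D \<in> real_mats"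
proof -
  have *: "four_block_mat A B C D $$ (i, j) \<in> \<real>" if "i < n + m" "j < n + m" for i j
    using R c that by (simp add: real_mats_iff)
  have "A $$ (i, j) \<in> \<real>" if "i < n" "j < n" for i j
    using *[of i j] c that by auto
  then show "A \<in> real_mats" using c by (simp add: real_mats_iff)
  have "B $$ (i, j) \<in> \<real>" if "i < n" "j < m" for i j
    using *[of i "j + n"] c that by auto
  then show "B \<in> real_mats" using c by (simp add: real_mats_iff)
  have "C $$ (i, j) \<in> \<real>" if "i < m" "j < n" for i j
    using *[of "i + n" j] c that by auto
  then show "C \<in> real_mats" using c by (simp add: real_mats_iff)
  have "D $$ (i, j) \<in> \<real>" if "i < m" "j < m" for i j
    using *[of "i + n" "j + n"] c that by auto
  then show "D \<in> real_mats" using c by (simp add: real_mats_iff)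
qed

text \<open>The resolvent formula is silent at eigenvalues of \<open>A\<close>, but realness is
  demanded at every real point that is not a pole, also where reduction has cancelled an eigenvalue.
  For each entry a polynomial \<open>h\<close> that vanishes at infinitely many real points, hence
  identically, closes this gap.\<close>

lemma real_valued_off_finite_set:
  assumes T: "finite T"
    and real: "\<And>s. s \<in> \<real> \<Longrightarrow> s \<notin> T \<Longrightarrow> \<not> has_pole F s \<and> value_at F s \<in> real_mats"
    and s: "s \<in> \<real>" "\<not> has_pole F s"
  shows "elements_mat (value_at F s) \<subseteq> \<real>"
proof -
  have "poly (num f) s / poly (den f) s \<in> \<real>" if f: "f \<in> elements_mat F" for f
  proof -
    \<comment> \<open>Conjugating the coefficients instead of the values keeps \<open>h\<close> a
      polynomial. On the real axis the two agree, and there \<open>h\<close> is zero wherever the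
      quotient is defined and real.\<close>
    define h where "h = num f * map_poly cnj (den f) - map_poly cnj (num f) * den f"
    have h: "poly h t = poly (num f) t * cnj (poly (den f) t) - cnj (poly (num f) t) * poly (den f) t"
      if "t \<in> \<real>" for t
      using that by (simp add: h_def Reals_cnj_iff)
    have "poly h t = 0" if t: "t \<in> \<real> - T" for t
    proof -
      have "poly (den f) t \<noteq> 0" and "poly (num f) t / poly (den f) t \<in> \<real>"
        using real[of t] t f by (auto simp: has_pole_def value_at_def real_mats_def)
      then show ?thesis
        using t h[of t] by (simp add: Reals_cnj_iff field_simps)
    qed
    then have "\<real> - T \<subseteq> {t. poly h t = 0}" by blast
    moreover have "infinite (\<real> - T)"
    proof -
      have "infinite (\<real> :: complex set)"
        unfolding Reals_def using finite_imageD[OF _ inj_of_real] infinite_UNIV_char_0 by blast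
      then show ?thesis
        using T by simp
    qed
    ultimately have "h = 0"
      using poly_roots_finite[of h] finite_subset by blast
    moreover have "poly (den f) s \<noteq> 0"
      using s f by (auto simp: has_pole_def)
    ultimately show ?thesis
      using h[OF s(1)] by (simp add: Reals_cnj_iff field_simps)
  qed
  then show ?thesis
    by (auto simp: value_at_def)
qed

lemma finite_eigenvalues:
  fixes A :: "complex mat"
  assumes A: "A \<in> carrier_mat n n"
  shows "finite {s. det (s \<cdot>\<^sub>m 1\<^sub>m n - A) = 0}"
  using poly_roots_finite[OF char_poly_nonzero[OF A]] by (simp add: poly_char_poly[OF A])

lemma positive_real_functions_iff:
  "F \<in> positive_real_functions n m \<longleftrightarrow> F \<in> positive_functions n m \<and>
    (\<forall>s \<in> \<real>. \<not> has_pole F s \<longrightarrow> elements_mat (value_at F s) \<subseteq> \<real>)"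
  by (auto simp: positive_real_functions_def positive_functions_def positive_real_def)

text \<open>For real \<open>R\<close> and real \<open>t\<close> the resolvent is a real matrix, so
  the transfer function is real outside the spectrum of \<open>A\<close>.\<close>

lemma realization_arrays_positive_real_functions:
  "realization_arrays n m (positive_real_functions n m) \<inter> real_mats = dissipative n m \<inter> real_mats"
proof -
  have "R \<in> realization_arrays n m (positive_real_functions n m)"
    if R: "R \<in> dissipative n m" and real: "R \<in> real_mats" for R
  proof -
    obtain A B C D where eq: "R = four_block_mat A B C D"
      and c: "A \<in> carrier_mat n n" "B \<in> carrier_mat n m" "C \<in> carrier_mat m n" "D \<in> carrier_mat m m"
      by (rule dissipative_blocks[OF R])
    define F where "F = transfer_function A B C D"
    have r: "realizes n m A B C D F"
      unfolding F_def by (rule realizes_transfer_function[OF c])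
    note reals = four_block_mat_in_real_matsD[OF c real[unfolded eq]]
    have "elements_mat (value_at F s) \<subseteq> \<real>" if "s \<in> \<real>" "\<not> has_pole F s" for s
    proof (rule real_valued_off_finite_set[OF finite_eigenvalues[OF c(1)] _ that])
      fix t :: complex
      assume t: "t \<in> \<real>" "t \<notin> {t. det (t \<cdot>\<^sub>m 1\<^sub>m n - A) = 0}"
      then have det: "det (t \<cdot>\<^sub>m 1\<^sub>m n - A) \<noteq> 0" by simp
      have M: "t \<cdot>\<^sub>m 1\<^sub>m n - A \<in> carrier_mat n n" by (rule minus_carrier_mat[OF c(1)])
      have "t \<cdot>\<^sub>m 1\<^sub>m n - A \<in> real_mats"
        using reals(1) c(1) t(1) by (auto simp: real_mats_iff)
      note G = the_mat_inverse(1)[OF M det] the_mat_inverse_in_real_mats[OF M det this]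
      have "C * the (mat_inverse (t \<cdot>\<^sub>m 1\<^sub>m n - A)) * B + D \<in> real_mats"
        using c reals G
        by (intro add_in_real_mats[of _ m m] mult_in_real_mats[of _ m n _ m] mult_in_real_mats[of _ m n _ n]) auto
      then show "\<not> has_pole F t \<and> value_at F t \<in> real_mats"
        using r det by (simp add: realizes_def)
    qed
    then have "F \<in> positive_real_functions n m"
      using transfer_function_in_positive_functions[OF R[unfolded eq] c]
      by (simp add: positive_real_functions_iff F_def)
    then show ?thesis
      using four_block_mat_in_realization_arrays[OF R[unfolded eq] r] by (simp add: eq)
  qed
  then show ?thesis
    using realization_arrays_subset_dissipative by blast
qed

section \<open>Inverse arrays\<close>

lemma mat_mult_eq_oneI:
  fixes W V :: "'a :: comm_ring_1 mat"
  assumes W: "W \<in> carrier_mat k k" and V: "V \<in> carrier_mat k k"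
    and id: "\<And>u. u \<in> carrier_vec k \<Longrightarrow> W *\<^sub>v (V *\<^sub>v u) = u"
  shows "W * V = 1\<^sub>m k"
proof (rule eq_matI)
  fix i j assume "i < dim_row (1\<^sub>m k :: 'a mat)" "j < dim_col (1\<^sub>m k :: 'a mat)"
  then have ij: "i < k" "j < k" by auto
  have "(P *\<^sub>v unit_vec k j) $ i = P $$ (i, j)" if "P \<in> carrier_mat k k" for P :: "'a mat"
    using that ij by simp
  then have "(W * V) $$ (i, j) = ((W * V) *\<^sub>v unit_vec k j) $ i"
    using mult_carrier_mat[OF W V] by metis
  also have "\<dots> = unit_vec k j $ i"
    by (simp only: assoc_mult_mat_vec[OF W V unit_vec_carrier] id[OF unit_vec_carrier])
  finally show "(W * V) $$ (i, j) = 1\<^sub>m k $$ (i, j)"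
    using ij by simp
qed (use W V in auto)

text \<open>
  If \<open>R\<close> maps \<open>(x, u)\<close> to \<open>(s x, y)\<close>, then \<open>R\<inverse>\<close> maps \<open>(s x, y)\<close> to \<open>(x, u)\<close>. So
  inverting the array turns \<open>F(s)\<close> into \<open>F(1/s)\<inverse>\<close>.
\<close>

lemma value_at_inverse_array:
  assumes r: "realizes n m A B C D F" and r': "realizes n m A' B' C' D' F'"
    and SR: "four_block_mat A' B' C' D' * four_block_mat A B C D = 1\<^sub>m (n + m)"
    and t: "t \<noteq> 0" and det: "det (inverse t \<cdot>\<^sub>m 1\<^sub>m n - A) \<noteq> 0"
    and det': "det (t \<cdot>\<^sub>m 1\<^sub>m n - A') \<noteq> 0"
  shows "value_at F' t * value_at F (inverse t) = 1\<^sub>m m"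
proof (rule mat_mult_eq_oneI)
  have c: "A \<in> carrier_mat n n" "B \<in> carrier_mat n m" "C \<in> carrier_mat m n" "D \<in> carrier_mat m m"
    and c': "A' \<in> carrier_mat n n" "B' \<in> carrier_mat n m" "C' \<in> carrier_mat m n" "D' \<in> carrier_mat m m"
    using r r' by (auto simp: realizes_def)
  show V: "value_at F' t \<in> carrier_mat m m" "value_at F (inverse t) \<in> carrier_mat m m"
    using r r' by (auto simp: realizes_def value_at_def)
  fix u :: "complex vec" assume u: "u \<in> carrier_vec m"
  obtain x where x: "x \<in> carrier_vec n" and eq: "A *\<^sub>v x + B *\<^sub>v u = inverse t \<cdot>\<^sub>v x"
    by (rule ex_state[OF c(1,2) det u])
  \<comment> \<open>\<open>z\<close> is the state part of the image of \<open>x\<close> and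
    \<open>u\<close>. Since \<open>x\<close> is \<open>t\<close> times \<open>z\<close>, the inverse
    array has state \<open>z\<close>, input \<open>y\<close> and output \<open>u\<close> at
    frequency \<open>t\<close>.\<close>
  define z where "z = inverse t \<cdot>\<^sub>v x"
  define y where "y = value_at F (inverse t) *\<^sub>v u"
  have z: "z \<in> carrier_vec n" using x by (simp add: z_def)
  have y: "y \<in> carrier_vec m" using V(2) u by (simp add: y_def)
  have tz: "x = t \<cdot>\<^sub>v z" using t x by (intro eq_vecI) (auto simp: z_def)
  have y_eq: "y = C *\<^sub>v x + D *\<^sub>v u"
    unfolding y_def by (rule value_at_mult_vec[OF r det x u eq])
  have xu: "x @\<^sub>v u \<in> carrier_vec (n + m)" using x u by simp
  have "four_block_mat A B C D *\<^sub>v (x @\<^sub>v u) = z @\<^sub>v y"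
    by (simp only: four_block_mat_mult_vec[OF c x u] eq y_eq z_def)
  then have "four_block_mat A' B' C' D' *\<^sub>v (z @\<^sub>v y) = x @\<^sub>v u"
    using assoc_mult_mat_vec[OF four_block_carrier_mat[OF c'(1,4), of B' C']
        four_block_carrier_mat[OF c(1,4), of B C] xu] xu
    by (simp add: SR)
  then have "(A' *\<^sub>v z + B' *\<^sub>v y) @\<^sub>v (C' *\<^sub>v z + D' *\<^sub>v y) = x @\<^sub>v u"
    by (simp only: four_block_mat_mult_vec[OF c' z y])
  then have "A' *\<^sub>v z + B' *\<^sub>v y = x" "C' *\<^sub>v z + D' *\<^sub>v y = u"
    using append_vec_eq[of "A' *\<^sub>v z + B' *\<^sub>v y" n x] c' y z x by auto
  then show "value_at F' t *\<^sub>v (value_at F (inverse t) *\<^sub>v u) = u"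
    using value_at_mult_vec[OF r' det' z y] by (simp add: tz y_def)
qed

text \<open>At almost all real \<open>t\<close> the value of the new function is a left inverse of
  the real matrix \<open>value_at F (inverse t)\<close>, hence real.\<close>

lemma realization_arrays_positive_real_closed_under_inversion:
  "closed_under_inversion (realization_arrays n m (positive_real_functions n m))"
  unfolding closed_under_inversion_def
proof (intro ballI impI)
  fix R assume R: "R \<in> realization_arrays n m (positive_real_functions n m)" and inv: "invertible_mat R"
  obtain A B C D F where F: "F \<in> positive_real_functions n m" and r: "realizes n m A B C D F"
    and eq: "R = four_block_mat A B C D"
    using R by (auto simp: realization_arrays_def)
  have Rd: "R \<in> dissipative n m"
    using R realization_arrays_subset_dissipative by blast
  have Rc: "R \<in> carrier_mat (n + m) (n + m)"
    by (rule dissipative_carrier[OF Rd])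
  define S where "S = the (mat_inverse R)"
  note S = the_mat_inverse[OF Rc invertible_mat_imp_det_nonzero[OF Rc inv], folded S_def]
  have Sd: "S \<in> dissipative n m"
    by (rule inverse_in_dissipative[OF Rd S(1,2)])
  obtain A' B' C' D' where eq': "S = four_block_mat A' B' C' D'"
    and c': "A' \<in> carrier_mat n n" "B' \<in> carrier_mat n m" "C' \<in> carrier_mat m n" "D' \<in> carrier_mat m m"
    by (rule dissipative_blocks[OF Sd])
  have A: "A \<in> carrier_mat n n" using r by (simp add: realizes_def)
  define F' where "F' = transfer_function A' B' C' D'"
  have r': "realizes n m A' B' C' D' F'"
    unfolding F'_def by (rule realizes_transfer_function[OF c'])
  \<comment> \<open>The points where the comparison may fail: zero, which has no reciprocal, the
    eigenvalues of \<open>A'\<close>, and the reciprocals of the eigenvalues of \<open>A\<close>. A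
    zero eigenvalue of \<open>A\<close> adds only the point 0, because
    \<open>inverse 0 = 0\<close>.\<close>
  define T where "T = insert 0 ({s. det (s \<cdot>\<^sub>m 1\<^sub>m n - A') = 0} \<union> inverse ` {s. det (s \<cdot>\<^sub>m 1\<^sub>m n - A) = 0})"
  have T: "finite T"
    by (simp add: T_def finite_eigenvalues[OF A] finite_eigenvalues[OF c'(1)])
  have "elements_mat (value_at F' s) \<subseteq> \<real>" if "s \<in> \<real>" "\<not> has_pole F' s" for s
  proof (rule real_valued_off_finite_set[OF T _ that])
    fix t :: complex assume t: "t \<in> \<real>" "t \<notin> T"
    then have t0: "t \<noteq> 0" and det': "det (t \<cdot>\<^sub>m 1\<^sub>m n - A') \<noteq> 0"
      by (auto simp: T_def)
    have det: "det (inverse t \<cdot>\<^sub>m 1\<^sub>m n - A) \<noteq> 0"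
    proof
      assume "det (inverse t \<cdot>\<^sub>m 1\<^sub>m n - A) = 0"
      then have "inverse (inverse t) \<in> T" unfolding T_def by blast
      then show False using t(2) by simp
    qed
    have V: "value_at F' t \<in> carrier_mat m m" "value_at F (inverse t) \<in> carrier_mat m m"
      using r r' by (auto simp: realizes_def value_at_def)
    have "\<not> has_pole F (inverse t)"
      using r det by (simp add: realizes_def)
    then have "value_at F (inverse t) \<in> real_mats"
      using F t(1) by (auto simp: positive_real_functions_iff real_mats_def)
    moreover have "value_at F' t * value_at F (inverse t) = 1\<^sub>m m"
      by (rule value_at_inverse_array[OF r r' _ t0 det det']) (use S(3) in \<open>simp add: eq eq'\<close>)
    ultimately have "value_at F' t \<in> real_mats"
      by (intro left_inverse_in_real_mats[OF V(2,1)])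
    then show "\<not> has_pole F' t \<and> value_at F' t \<in> real_mats"
      using r' det' by (simp add: realizes_def)
  qed
  then have "F' \<in> positive_real_functions n m"
    using transfer_function_in_positive_functions[OF Sd[unfolded eq'] c']
    by (simp add: positive_real_functions_iff F'_def)
  then show "the (mat_inverse R) \<in> realization_arrays n m (positive_real_functions n m)"
    using four_block_mat_in_realization_arrays[OF Sd[unfolded eq'] r'] by (simp add: eq' flip: S_def)
qed

lemma the_mat_inverse_in_dissipative:
  assumes "R \<in> dissipative n m" and "invertible_mat R"
  shows "the (mat_inverse R) \<in> dissipative n m"
  using the_mat_inverse[OF dissipative_carrier[OF assms(1)]] assms
    invertible_mat_imp_det_nonzero[OF dissipative_carrier[OF assms(1)]]
  by (blast intro: inverse_in_dissipative)

section \<open>Convexity\<close>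

lemma sum_mat_in:
  fixes M :: "nat \<Rightarrow> 'a :: comm_monoid_add mat"
  assumes "0\<^sub>m p p \<in> \<R>"
    and "\<And>A B. A \<in> \<R> \<Longrightarrow> B \<in> \<R> \<Longrightarrow> A + B \<in> \<R>"
    and "\<R> \<subseteq> carrier_mat p p" and "\<And>j. j < k \<Longrightarrow> M j \<in> \<R>"
  shows "mat p p (\<lambda>ij. \<Sum>j<k. M j $$ ij) \<in> \<R>"
  using assms(4)
proof (induction k)
  case 0
  have "mat p p (\<lambda>ij. \<Sum>j<0. M j $$ ij) = 0\<^sub>m p p" by (intro eq_matI) auto
  then show ?case using assms(1) by simp
next
  case (Suc k)
  have "M k \<in> carrier_mat p p" using Suc.prems assms(3) by blast
  then have "mat p p (\<lambda>ij. \<Sum>j<Suc k. M j $$ ij) = mat p p (\<lambda>ij. \<Sum>j<k. M j $$ ij) + M k"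
    by (intro eq_matI) auto
  then show ?case
    using assms(2) Suc by simp
qed

text \<open>A combination of any length is a sum of single congruences, so induction leaves one
  congruence, one binary sum, and the zero matrix for the empty combination.\<close>

lemma matrix_convex_coneI:
  assumes "0\<^sub>m (n + m) (n + m) \<in> \<R>"
    and "\<And>A B. A \<in> \<R> \<Longrightarrow> B \<in> \<R> \<Longrightarrow> A + B \<in> \<R>"
    and "\<R> \<subseteq> carrier_mat (n + m) (n + m)"
    and "\<And>R A D T. R \<in> \<R> \<Longrightarrow> A \<in> carrier_mat n n \<Longrightarrow> D \<in> carrier_mat m m \<Longrightarrow>
      T = four_block_mat A (0\<^sub>m n m) (0\<^sub>m m n) D \<Longrightarrow> elements_mat T \<subseteq> K \<Longrightarrow>
      mat_adjoint T * R * T \<in> \<R>"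
  shows "matrix_convex_cone K n m \<R>"
  unfolding matrix_convex_cone_def
proof (intro conjI allI impI)
  fix k and R \<upsilon> :: "nat \<Rightarrow> complex mat"
  assume R: "\<forall>j<k. R j \<in> \<R>"
    and \<upsilon>: "\<forall>j<k. elements_mat (\<upsilon> j) \<subseteq> K \<and>
      (\<exists>\<upsilon>n \<in> carrier_mat n n. \<exists>\<upsilon>m \<in> carrier_mat m m.
         \<upsilon> j = four_block_mat \<upsilon>n (0\<^sub>m n m) (0\<^sub>m m n) \<upsilon>m)"
  have "mat_adjoint (\<upsilon> j) * R j * \<upsilon> j \<in> \<R>" if j: "j < k" for j
  proof -
    obtain A D where "A \<in> carrier_mat n n" "D \<in> carrier_mat m m"
      "\<upsilon> j = four_block_mat A (0\<^sub>m n m) (0\<^sub>m m n) D"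
      using \<upsilon> j by blast
    then show ?thesis
      using R \<upsilon> j assms(4)[of "R j" A D "\<upsilon> j"] by blast
  qed
  then show "mat (n + m) (n + m) (\<lambda>ij. \<Sum>j<k. (mat_adjoint (\<upsilon> j) * R j * \<upsilon> j) $$ ij) \<in> \<R>"
    by (intro sum_mat_in assms(1,2,3))
qed (rule assms(3))

theorem theorem6p5:
  fixes n m :: nat
  shows
    "(let \<R> = realization_arrays n m (positive_functions n m) in
        matrix_convex_cone UNIV n m \<R> \<and> closed_under_inversion \<R>) \<and>
     (let \<R> = realization_arrays n m (positive_real_functions n m) \<inter> real_mats in
        matrix_convex_cone \<real> n m \<R> \<and> closed_under_inversion \<R>) \<and>
     closed_under_inversion (realization_arrays n m (positive_real_functions n m))"
proof -
  have "matrix_convex_cone UNIV n m (dissipative n m)"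
    by (rule matrix_convex_coneI)
      (auto intro: zero_in_dissipative add_in_dissipative congruence_in_dissipative dest: dissipative_carrier)
  moreover have "closed_under_inversion (dissipative n m)"
    by (simp add: closed_under_inversion_def the_mat_inverse_in_dissipative)
  moreover have "matrix_convex_cone \<real> n m (dissipative n m \<inter> real_mats)"
  proof (rule matrix_convex_coneI)
    show "0\<^sub>m (n + m) (n + m) \<in> dissipative n m \<inter> real_mats"
      by (simp add: zero_in_dissipative real_mats_iff)
    show "A + B \<in> dissipative n m \<inter> real_mats"
      if "A \<in> dissipative n m \<inter> real_mats" "B \<in> dissipative n m \<inter> real_mats" for A B
      using that add_in_real_mats[OF dissipative_carrier dissipative_carrier]
      by (blast intro: add_in_dissipative)
    show "dissipative n m \<inter> real_mats \<subseteq> carrier_mat (n + m) (n + m)"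
      using dissipative_carrier by blast
  next
    fix R A D T :: "complex mat"
    assume R: "R \<in> dissipative n m \<inter> real_mats" and AD: "A \<in> carrier_mat n n" "D \<in> carrier_mat m m"
      and T: "T = four_block_mat A (0\<^sub>m n m) (0\<^sub>m m n) D" "elements_mat T \<subseteq> \<real>"
    have Tc: "T \<in> carrier_mat (n + m) (n + m)" using AD T(1) by simp
    have Tr: "T \<in> real_mats" using T(2) by (simp add: real_mats_def)
    have Rc: "R \<in> carrier_mat (n + m) (n + m)" using R dissipative_carrier by blast
    have "mat_adjoint T * R * T \<in> real_mats"
      using R Tr mat_adjoint_in_real_mats[OF Tr]
      by (intro mult_in_real_mats[OF mult_carrier_mat[OF mat_adjoint_carrier[OF Tc] Rc] Tc]
          mult_in_real_mats[OF mat_adjoint_carrier[OF Tc] Rc]) auto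
    then show "mat_adjoint T * R * T \<in> dissipative n m \<inter> real_mats"
      using congruence_in_dissipative[OF _ AD] R T(1) by simp
  qed
  moreover have "closed_under_inversion (dissipative n m \<inter> real_mats)"
    unfolding closed_under_inversion_def
  proof (intro ballI impI)
    fix R assume R: "R \<in> dissipative n m \<inter> real_mats" and inv: "invertible_mat R"
    have Rc: "R \<in> carrier_mat (n + m) (n + m)" using R dissipative_carrier by blast
    show "the (mat_inverse R) \<in> dissipative n m \<inter> real_mats"
      using the_mat_inverse_in_dissipative[of R n m] R inv
        the_mat_inverse_in_real_mats[OF Rc invertible_mat_imp_det_nonzero[OF Rc inv]] by blast
  qed
  \<comment> \<open>The two descriptions of arrays by \<open>dissipative\<close> settle the first
    two conjuncts; the third enters through its own lemma.\<close>
  ultimately show ?thesis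
    by (simp add: Let_def realization_arrays_positive_functions realization_arrays_positive_real_functions
        realization_arrays_positive_real_closed_under_inversion)
qed

end
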